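(* If $G$ is one of the following graphs, then $mvd(G)=2$: (i) the grid $G=P_m\Box P_n$ where either $m,n\geq 2$, or $\{m,n\}=\{1,2\}$; (ii) the Petersen graph.
   Context: $P_m$ is the path on $m$ vertices. $G\Box H$ is the Cartesian product: vertex set $V(G)\times V(H)$, with $(u,v)$ adjacent to $(u',v')$ iff either $u=u'$ and $vv'\in E(H)$, or $v=v'$ and $uu'\in E(G)$. For a vertex-colored graph and two nonadjacent vertices $x,y$, an $x$-$y$ vertex cut is a set $S\subseteq V(G)\setminus\{x,y\}$ such that $x$ and $y$ lie in different components of $G-S$; it is monochromatic if all its vertices have the same color. A vertex-coloring is an MVD-coloring if every pair of nonadjacent vertices has a monochromatic vertex cut separating them. $mvd(G)$ is the maximum number of colors used by an MVD-coloring of $G$. *)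

theory Defs
  imports "Graph_Theory.Graph_Theory"
begin

text \<open>Finite simple graphs are encoded as in \<open>pair_graph\<close>: finite, loop-free and symmetric
  digraphs, every undirected edge being represented by its two arcs.\<close>

definition path_graph :: "nat \<Rightarrow> nat pair_pre_digraph" where
  "path_graph m =
     \<lparr>pverts = {..<m}, parcs = {(i, j). i < m \<and> j < m \<and> (j = Suc i \<or> i = Suc j)}\<rparr>"

definition cartesian_product ::
  "'a pair_pre_digraph \<Rightarrow> 'b pair_pre_digraph \<Rightarrow> ('a \<times> 'b) pair_pre_digraph"
  (infixr \<open>\<box>\<close> 70) where
  "G \<box> H =
     \<lparr>pverts = pverts G \<times> pverts H,
      parcs = {((u, v), (u', v')).
        u \<in> pverts G \<and> u' \<in> pverts G \<and> v \<in> pverts H \<and> v' \<in> pverts H \<and>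
        (u = u' \<and> (v, v') \<in> parcs H \<or> v = v' \<and> (u, u') \<in> parcs G)}\<rparr>"

text \<open>The Petersen graph in its description as a Kneser graph: the vertices are the 2-element
  subsets of a 5-element set, and two of them are adjacent iff they are disjoint.\<close>

definition petersen_graph :: "nat set pair_pre_digraph" where
  "petersen_graph =
     (let V = {A. A \<subseteq> {..<5} \<and> card A = 2}
      in \<lparr>pverts = V, parcs = {(A, B). A \<in> V \<and> B \<in> V \<and> A \<inter> B = {}}\<rparr>)"

text \<open>\<open>with_proj G \<restriction> (pverts G - S)\<close> is the graph \<open>G - S\<close>. Since all arcs come in opposite pairs,
  its strongly connected components are the components of the undirected graph.\<close>

definition vertex_cut :: "'a pair_pre_digraph \<Rightarrow> 'a \<Rightarrow> 'a \<Rightarrow> 'a set \<Rightarrow> bool" where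
  "vertex_cut G x y S \<longleftrightarrow>
     S \<subseteq> pverts G - {x, y} \<and>
     pre_digraph.scc_of (with_proj G \<restriction> (pverts G - S)) x \<noteq>
     pre_digraph.scc_of (with_proj G \<restriction> (pverts G - S)) y"

definition monochromatic :: "('a \<Rightarrow> nat) \<Rightarrow> 'a set \<Rightarrow> bool" where
  "monochromatic c S \<longleftrightarrow> (\<forall>u\<in>S. \<forall>v\<in>S. c u = c v)"

definition mvd_coloring :: "'a pair_pre_digraph \<Rightarrow> ('a \<Rightarrow> nat) \<Rightarrow> bool" where
  "mvd_coloring G c \<longleftrightarrow>
     (\<forall>x\<in>pverts G. \<forall>y\<in>pverts G. x \<noteq> y \<and> (x, y) \<notin> parcs G \<longrightarrow>
        (\<exists>S. vertex_cut G x y S \<and> monochromatic c S))"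

definition mvd :: "'a pair_pre_digraph \<Rightarrow> nat" where
  "mvd G = Max {card (c ` pverts G) | c. mvd_coloring G c}"

lemma pair_graph_path_graph: "pair_graph (path_graph m)"
proof unfold_locales
  show "finite (parcs (path_graph m))"
    by (rule finite_subset[of _ "{..<m} \<times> {..<m}"]) (auto simp: path_graph_def)
qed (auto simp: path_graph_def symmetric_def sym_def)

lemma pair_graph_cartesian_product:
  assumes "pair_graph G" "pair_graph H"
  shows "pair_graph (G \<box> H)"
proof -
  interpret G: pair_graph G by fact
  interpret H: pair_graph H by fact
  show ?thesis
  proof unfold_locales
    show "finite (parcs (G \<box> H))"
      by (rule finite_subset[of _ "(pverts G \<times> pverts H) \<times> (pverts G \<times> pverts H)"])
        (auto simp: cartesian_product_def)
  qed (auto simp: cartesian_product_def symmetric_def sym_def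
      dest: G.no_loops' H.no_loops' G.arcs_symmetric H.arcs_symmetric)
qed

lemma pair_graph_petersen_graph: "pair_graph petersen_graph"
proof -
  have fin: "finite {A. A \<subseteq> {..<5::nat} \<and> card A = 2}"
    by (rule finite_subset[of _ "Pow {..<5}"]) auto
  show ?thesis
  proof unfold_locales
    show "finite (pverts petersen_graph)"
      using fin by (simp add: petersen_graph_def)
    show "finite (parcs petersen_graph)"
      by (rule finite_subset[OF _ finite_cartesian_product[OF fin fin]])
        (auto simp: petersen_graph_def Let_def)
  qed (auto simp: petersen_graph_def Let_def symmetric_def sym_def)
qed

text \<open>The maximum in the definition of \<open>mvd\<close> is taken over a finite nonempty set.\<close>

lemma mvd_coloring_const:
  assumes "pair_graph G"
  shows "mvd_coloring G (\<lambda>_. k)"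
  unfolding mvd_coloring_def
proof (intro ballI impI)
  fix x y assume xy: "x \<in> pverts G" "y \<in> pverts G" "x \<noteq> y \<and> (x, y) \<notin> parcs G"
  interpret pair_graph G by fact
  let ?S = "pverts G - {x, y}"
  let ?H = "with_proj G \<restriction> (pverts G - ?S)"
  have V: "pverts G - ?S = {x, y}" using xy by auto
  interpret H: wf_digraph ?H by (rule wellformed_induce_subgraph)
  have ends: "arcs_ends ?H = {}"
    using xy no_loops' arcs_symmetric
    by (auto simp: V arcs_ends_conv induce_subgraph_def)
  have "\<not> x \<rightarrow>\<^sup>*\<^bsub>?H\<^esub> y"
  proof
    assume "x \<rightarrow>\<^sup>*\<^bsub>?H\<^esub> y"
    then show False
      using xy ends by (cases rule: H.converse_reachable_cases) auto
  qed
  moreover have "y \<in> pre_digraph.scc_of ?H y"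
    by (rule H.in_scc_of_self) (simp add: V)
  ultimately have "pre_digraph.scc_of ?H x \<noteq> pre_digraph.scc_of ?H y"
    by (auto simp: pre_digraph.scc_of_def)
  then show "\<exists>S. vertex_cut G x y S \<and> monochromatic (\<lambda>_. k) S"
    by (intro exI[of _ ?S]) (auto simp: vertex_cut_def monochromatic_def)
qed

lemma mvd_set_finite_nonempty:
  assumes "pair_graph G"
  shows "finite {card (c ` pverts G) | c. mvd_coloring G c}"
    and "{card (c ` pverts G) | c. mvd_coloring G c} \<noteq> {}"
proof -
  interpret pair_graph G by fact
  show "finite {card (c ` pverts G) | c. mvd_coloring G c}"
    by (rule finite_subset[of _ "{..card (pverts G)}"]) (auto intro: card_image_le)
  show "{card (c ` pverts G) | c. mvd_coloring G c} \<noteq> {}"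
    using mvd_coloring_const[OF assms] by blast
qed

end

theory Submission
  imports Defs
begin

text \<open>In a proper 2-coloring of a bipartite graph every neighbourhood is monochromatic and isolates
  its vertex, so grids admit two colors. Conversely, any cut separating two opposite corners of a
  4-cycle contains the other two corners; in a grid this forces diagonal neighbours to agree in
  color, leaving one color per parity class.

  In the Petersen graph, color a vertex by whether it contains 0: the vertices containing 0 have
  monochromatic neighbourhoods, and deleting them leaves a perfect matching. For the upper bound, let
  \<open>v\<close> be a vertex. Two neighbours of \<open>v\<close> are separated only by a cut through \<open>v\<close>, which must also
  meet every path of length 3 between them. Over the three pairs of neighbours, three such paths with
  pairwise disjoint interiors can be chosen, so the color class of \<open>v\<close> has at least 4 of the 10 vertices.\<close>

section \<open>Vertex cuts via closed sets\<close>

text \<open>The set reached from \<open>x\<close> in \<open>G - S\<close> is such a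
  \<open>K\<close>, and conversely any such \<open>K\<close> traps every walk from \<open>x\<close>
  in \<open>G - S\<close>. This form replaces components by a closure condition that short walks can
  be tested against directly.\<close>

lemma vertex_cut_iff_closed_set:
  assumes "pair_graph G" "x \<in> pverts G" "y \<in> pverts G"
  shows "vertex_cut G x y S \<longleftrightarrow> S \<subseteq> pverts G - {x, y} \<and>
    (\<exists>K. x \<in> K \<and> y \<notin> K \<and> (\<forall>u\<in>K. \<forall>v. (u, v) \<in> parcs G \<and> v \<notin> S \<longrightarrow> v \<in> K))"
    (is "_ \<longleftrightarrow> ?sub \<and> (\<exists>K. ?closed K)")
proof -
  interpret pair_graph G by fact
  let ?H = "with_proj G \<restriction> (pverts G - S)"
  interpret H: wf_digraph ?H by (rule wellformed_induce_subgraph)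
  have arc: "u \<rightarrow>\<^bsub>?H\<^esub> v \<longleftrightarrow> (u, v) \<in> parcs G \<and> u \<notin> S \<and> v \<notin> S" for u v
    using in_arcsD1[of u v] in_arcsD2[of u v] by (force simp: arcs_ends_conv)
  have sym: "symmetric ?H"
    unfolding symmetric_def sym_def using arc arcs_symmetric by blast
  show ?thesis
  proof (intro iffI conjI; (elim conjE exE)?)
    assume cut: "vertex_cut G x y S"
    then show sub: ?sub by (simp add: vertex_cut_def)
    \<comment> \<open>By symmetry, reachability is mutual, so a walk from \<open>x\<close> to
      \<open>y\<close> would merge the two components.\<close>
    have "\<not> x \<rightarrow>\<^sup>*\<^bsub>?H\<^esub> y"
    proof
      assume "x \<rightarrow>\<^sup>*\<^bsub>?H\<^esub> y"
      moreover from symmetric_reachable[OF sym this] have "y \<rightarrow>\<^sup>*\<^bsub>?H\<^esub> x" .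
      ultimately have "x \<in> pre_digraph.scc_of ?H y"
        by (simp add: pre_digraph.scc_of_def)
      then show False
        using cut H.scc_of_eq by (auto simp: vertex_cut_def)
    qed
    moreover have "x \<rightarrow>\<^sup>*\<^bsub>?H\<^esub> x" using assms sub by auto
    moreover have "x \<rightarrow>\<^sup>*\<^bsub>?H\<^esub> v" if "x \<rightarrow>\<^sup>*\<^bsub>?H\<^esub> u" "(u, v) \<in> parcs G" "v \<notin> S" for u v
    proof -
      have "u \<notin> S" using H.reachable_in_verts(2)[OF that(1)] by simp
      then have "u \<rightarrow>\<^bsub>?H\<^esub> v" using that arc by blast
      with that(1) show ?thesis by (rule H.reachable_adj_trans)
    qed
    ultimately show "\<exists>K. ?closed K"
      by (intro exI[of _ "{v. x \<rightarrow>\<^sup>*\<^bsub>?H\<^esub> v}"]) auto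
  next
    fix K assume sub: ?sub and K: "x \<in> K" "y \<notin> K"
      and closed: "\<forall>u\<in>K. \<forall>v. (u, v) \<in> parcs G \<and> v \<notin> S \<longrightarrow> v \<in> K"
    have "v \<in> K" if "x \<rightarrow>\<^sup>*\<^bsub>?H\<^esub> v" for v
      using that
    proof (induct rule: H.reachable_induct)
      case base
      show ?case by (rule K)
    next
      case (step u v)
      then show ?case using closed arc by blast
    qed
    with K have "y \<notin> pre_digraph.scc_of ?H x"
      by (auto simp: pre_digraph.scc_of_def)
    moreover have "y \<in> pre_digraph.scc_of ?H y"
      using assms sub by (intro H.in_scc_of_self) auto
    ultimately show "vertex_cut G x y S"
      using sub by (auto simp: vertex_cut_def)
  qed
qed

lemma vertex_cut_meets_walk2:
  assumes "pair_graph G" "vertex_cut G x y S" "(x, u) \<in> parcs G" "(u, y) \<in> parcs G"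
  shows "u \<in> S"
proof -
  interpret pair_graph G by fact
  have "x \<in> pverts G" "y \<in> pverts G" using assms in_arcsD1 in_arcsD2 by blast+
  from assms(2)[unfolded vertex_cut_iff_closed_set[OF assms(1) this]] assms(3,4)
  show ?thesis by blast
qed

text \<open>If \<open>S\<close> missed both inner vertices, the closed set around \<open>x\<close>
  would spread along the walk to \<open>y\<close>.\<close>

lemma vertex_cut_meets_walk3:
  assumes "pair_graph G" "vertex_cut G x y S"
    "(x, u) \<in> parcs G" "(u, w) \<in> parcs G" "(w, y) \<in> parcs G"
  shows "u \<in> S \<or> w \<in> S"
proof -
  interpret pair_graph G by fact
  have "x \<in> pverts G" "y \<in> pverts G" using assms in_arcsD1 in_arcsD2 by blast+
  from assms(2)[unfolded vertex_cut_iff_closed_set[OF assms(1) this]] assms(3-5)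
  show ?thesis by blast
qed

text \<open>Deleting all neighbours isolates \<open>x\<close>, so \<open>{x}\<close> is the closed
  set.\<close>

lemma vertex_cut_neighbourhood:
  assumes "pair_graph G" "x \<in> pverts G" "y \<in> pverts G" "x \<noteq> y" "(x, y) \<notin> parcs G"
  shows "vertex_cut G x y {v. (x, v) \<in> parcs G}"
proof -
  interpret pair_graph G by fact
  have "{v. (x, v) \<in> parcs G} \<subseteq> pverts G - {x, y}"
    using assms in_arcsD2 no_loops' by blast
  then show ?thesis
    using assms by (auto simp: vertex_cut_iff_closed_set intro!: exI[of _ "{x}"])
qed

lemma vertex_cut_commute: "vertex_cut G x y S \<longleftrightarrow> vertex_cut G y x S"
  by (auto simp: vertex_cut_def)

section \<open>Color constraints from short walks\<close>

lemma mvd_coloring_common_neighbours: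
  assumes "pair_graph G" "mvd_coloring G c" "x \<noteq> y" "(x, y) \<notin> parcs G"
    "(x, u) \<in> parcs G" "(u, y) \<in> parcs G" "(x, v) \<in> parcs G" "(v, y) \<in> parcs G"
  shows "c u = c v"
proof -
  interpret pair_graph G by fact
  have "x \<in> pverts G" "y \<in> pverts G" using assms in_arcsD1 in_arcsD2 by blast+
  then obtain S where S: "vertex_cut G x y S" "monochromatic c S"
    using assms by (auto simp: mvd_coloring_def)
  have "u \<in> S" "v \<in> S"
    using vertex_cut_meets_walk2[OF assms(1) S(1)] assms by auto
  then show ?thesis using S(2) unfolding monochromatic_def by blast
qed

text \<open>The common neighbour \<open>v\<close> lies in every cut and thus fixes its color; the
  cut must also block the longer walk.\<close>

lemma mvd_coloring_walk3:
  assumes "pair_graph G" "mvd_coloring G c" "x \<noteq> y" "(x, y) \<notin> parcs G"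
    "(x, v) \<in> parcs G" "(v, y) \<in> parcs G"
    "(x, u) \<in> parcs G" "(u, w) \<in> parcs G" "(w, y) \<in> parcs G"
  shows "c u = c v \<or> c w = c v"
proof -
  interpret pair_graph G by fact
  have "x \<in> pverts G" "y \<in> pverts G" using assms in_arcsD1 in_arcsD2 by blast+
  then obtain S where S: "vertex_cut G x y S" "monochromatic c S"
    using assms by (auto simp: mvd_coloring_def)
  have "v \<in> S" "u \<in> S \<or> w \<in> S"
    using vertex_cut_meets_walk2[OF assms(1) S(1)] vertex_cut_meets_walk3[OF assms(1) S(1)] assms
    by auto
  then show ?thesis using S(2) unfolding monochromatic_def by blast
qed

lemma mvd_eqI:
  assumes "pair_graph G" "mvd_coloring G c" "card (c ` pverts G) = k"
    and "\<And>d. mvd_coloring G d \<Longrightarrow> card (d ` pverts G) \<le> k"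
  shows "mvd G = k"
  unfolding mvd_def using assms mvd_set_finite_nonempty(1)[OF assms(1)]
  by (intro Max_eqI) auto

section \<open>Grids\<close>

lemma pverts_grid: "pverts (path_graph m \<box> path_graph n) = {..<m} \<times> {..<n}"
  by (simp add: cartesian_product_def path_graph_def)

lemma parcs_grid_iff:
  "((i, j), (i', j')) \<in> parcs (path_graph m \<box> path_graph n) \<longleftrightarrow>
     i < m \<and> i' < m \<and> j < n \<and> j' < n \<and>
     (i = i' \<and> (j' = Suc j \<or> j = Suc j') \<or> j = j' \<and> (i' = Suc i \<or> i = Suc i'))"
  by (auto simp: cartesian_product_def path_graph_def)

lemma pair_graph_grid: "pair_graph (path_graph m \<box> path_graph n)"
  by (intro pair_graph_cartesian_product pair_graph_path_graph)

lemma mvd_coloring_grid_parity: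
  "mvd_coloring (path_graph m \<box> path_graph n) (\<lambda>(i, j). (i + j) mod 2)"
  unfolding mvd_coloring_def
proof (intro ballI impI)
  let ?G = "path_graph m \<box> path_graph n"
  fix x y assume xy: "x \<in> pverts ?G" "y \<in> pverts ?G" "x \<noteq> y \<and> (x, y) \<notin> parcs ?G"
  obtain i j where x: "x = (i, j)" by fastforce
  \<comment> \<open>Every arc changes the coordinate sum by one, so all neighbours of
    \<open>x\<close> have the opposite parity.\<close>
  have nb: "(case v of (a, b) \<Rightarrow> (a + b) mod 2) = Suc (i + j) mod 2" if "(x, v) \<in> parcs ?G" for v
    using that unfolding x by (cases v) (auto simp: parcs_grid_iff)
  have "monochromatic (\<lambda>(i, j). (i + j) mod 2) {v. (x, v) \<in> parcs ?G}"
    unfolding monochromatic_def using nb by simp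
  then show "\<exists>S. vertex_cut ?G x y S \<and> monochromatic (\<lambda>(i, j). (i + j) mod 2) S"
    using vertex_cut_neighbourhood[OF pair_graph_grid] xy by blast
qed

text \<open>In a unit square, the two ends of one diagonal are common neighbours of the two ends of
  the other.\<close>

lemma mvd_coloring_grid_diagonal:
  assumes "mvd_coloring (path_graph m \<box> path_graph n) c" "Suc i < m" "Suc j < n"
  shows "c (Suc i, Suc j) = c (i, j)" "c (i, Suc j) = c (Suc i, j)"
proof -
  show "c (Suc i, Suc j) = c (i, j)"
    by (rule mvd_coloring_common_neighbours[OF pair_graph_grid assms(1),
          where x = "(i, Suc j)" and y = "(Suc i, j)"]) (use assms in \<open>auto simp: parcs_grid_iff\<close>)
  show "c (i, Suc j) = c (Suc i, j)"
    by (rule mvd_coloring_common_neighbours[OF pair_graph_grid assms(1),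
          where x = "(i, j)" and y = "(Suc i, Suc j)"]) (use assms in \<open>auto simp: parcs_grid_iff\<close>)
qed

text \<open>Diagonal moves keep the parity of \<open>i + j\<close> and lead to \<open>(0, 0)\<close>
  or \<open>(0, 1)\<close>; the induction lowers \<open>i + j\<close> by two at a time.\<close>

lemma mvd_coloring_grid_parity_class:
  assumes c: "mvd_coloring (path_graph m \<box> path_graph n) c" and "2 \<le> m" "2 \<le> n"
    and "i < m" "j < n"
  shows "c (i, j) = c (0, (i + j) mod 2)"
  using assms(4,5)
proof (induction "i + j" arbitrary: i j rule: less_induct)
  case less
  note diag = mvd_coloring_grid_diagonal[OF c]
  consider a b where "i = Suc a" "j = Suc b" | a where "i = Suc (Suc a)" "j = 0"
    | b where "i = 0" "j = Suc (Suc b)" | "i = 1" "j = 0" | "i = 0" "j < 2"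
    by (metis One_nat_def less_2_cases_iff not0_implies_Suc)
  then show ?case
  proof cases
    case 1
    then show ?thesis using diag(1)[of a b] less.hyps[of a b] less.prems by simp
  next
    case 2
    \<comment> \<open>On the border no single diagonal move lowers the sum, so the route detours
      through \<open>(Suc a, 1)\<close>, which exists because \<open>2 \<le> n\<close>. The next
      case is its mirror image.\<close>
    have "c (i, j) = c (a, 0)"
      using 2 diag(2)[of "Suc a" 0] diag(1)[of a 0] less.prems \<open>2 \<le> n\<close> by simp
    then show ?thesis using 2 less.hyps[of a 0] less.prems by simp
  next
    case 3
    have "c (i, j) = c (0, b)"
      using 3 diag(2)[of 0 "Suc b"] diag(1)[of 0 b] less.prems \<open>2 \<le> m\<close> by simp
    then show ?thesis using 3 less.hyps[of 0 b] less.prems by simp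
  next
    case 4
    \<comment> \<open>The antidiagonal of the corner square joins \<open>(1, 0)\<close> to the
      representative \<open>(0, 1)\<close>.\<close>
    then show ?thesis using diag(2)[of 0 0] assms(2,3) by simp
  next
    case 5
    then show ?thesis by simp
  qed
qed

lemma mvd_grid:
  assumes "m \<ge> 2 \<and> n \<ge> 2 \<or> {m, n} = {1, 2}"
  shows "mvd (path_graph m \<box> path_graph n) = 2"
proof (rule mvd_eqI[OF pair_graph_grid mvd_coloring_grid_parity])
  let ?V = "pverts (path_graph m \<box> path_graph n)"
  let ?p = "\<lambda>(i, j). (i + j) mod 2 :: nat"
  have mn: "(0, 0) \<in> ?V" "(0, 1) \<in> ?V \<or> (1, 0) \<in> ?V"
    using assms by (auto simp: pverts_grid doubleton_eq_iff)
  have "?p ` ?V = {0, 1}"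
  proof
    show "?p ` ?V \<subseteq> {0, 1}" by auto
    show "{0, 1} \<subseteq> ?p ` ?V" using mn by (force intro: rev_image_eqI)
  qed
  then show "card (?p ` ?V) = 2" by simp
  fix d assume d: "mvd_coloring (path_graph m \<box> path_graph n) d"
  show "card (d ` ?V) \<le> 2"
  proof (cases "m \<ge> 2 \<and> n \<ge> 2")
    case True
    have "d ` ?V \<subseteq> {d (0, 0), d (0, 1)}"
    proof (rule image_subsetI)
      fix x assume x: "x \<in> ?V"
      obtain i j where ij: "x = (i, j)" by fastforce
      then have "d x = d (0, (i + j) mod 2)"
        using x mvd_coloring_grid_parity_class[OF d, of i j] True by (simp add: pverts_grid)
      then show "d x \<in> {d (0, 0), d (0, 1)}"
        by (metis insertCI not_mod_2_eq_0_eq_1)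
    qed
    then have "card (d ` ?V) \<le> card {d (0, 0), d (0, 1)}" by (intro card_mono) auto
    also have "\<dots> \<le> 2" by (simp add: card_insert_if)
    finally show ?thesis .
  next
    case False
    \<comment> \<open>Only the single edge remains, and two vertices carry at most two
      colors.\<close>
    with assms have "card ?V = 2" by (auto simp: pverts_grid doubleton_eq_iff)
    then show ?thesis using card_image_le[of ?V d] by (simp add: pverts_grid)
  qed
qed

section \<open>The Petersen graph\<close>

lemma pverts_petersen: "pverts petersen_graph = {A. A \<subseteq> {..<5} \<and> card A = 2}"
  by (simp add: petersen_graph_def Let_def)

lemma parcs_petersen_iff:
  "(A, B) \<in> parcs petersen_graph \<longleftrightarrow>
     A \<in> pverts petersen_graph \<and> B \<in> pverts petersen_graph \<and> A \<inter> B = {}"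
  by (auto simp: petersen_graph_def Let_def)

lemma pair_in_petersen: "{a, b} \<in> pverts petersen_graph \<longleftrightarrow> a < 5 \<and> b < 5 \<and> a \<noteq> b"
  by (auto simp: pverts_petersen card_insert_if)

lemma card_pverts_petersen: "card (pverts petersen_graph) = 10"
  using n_subsets[of "{..<5::nat}" 2] by (simp add: pverts_petersen numeral_eq_Suc)

lemma finite_pverts_petersen: "finite (pverts petersen_graph)"
  using card_pverts_petersen by (auto intro: card_ge_0_finite)

text \<open>The neighbours \<open>{c, d}\<close> and \<open>{c, e}\<close> of \<open>{a, b}\<close>
  are also joined by the path through \<open>{a, e}\<close> and \<open>{b, d}\<close>.\<close>

lemma mvd_coloring_petersen_walk:
  assumes "mvd_coloring petersen_graph f" "distinct [a, b, c, d, e]" "{a, b, c, d, e} \<subseteq> {..<5}"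
  shows "f {a, e} = f {a, b} \<or> f {b, d} = f {a, b}"
  by (rule mvd_coloring_walk3[OF pair_graph_petersen_graph assms(1),
        where x = "{c, d}" and y = "{c, e}"])
     (use assms(2,3) in \<open>auto simp: parcs_petersen_iff pair_in_petersen doubleton_eq_iff\<close>)

lemma petersen_color_class_card:
  assumes f: "mvd_coloring petersen_graph f" and v: "v \<in> pverts petersen_graph"
  shows "4 \<le> card {w \<in> pverts petersen_graph. f w = f v}"
proof -
  let ?C = "{w \<in> pverts petersen_graph. f w = f v}"
  obtain a b where ab: "v = {a, b}" "a \<noteq> b" "a < 5" "b < 5"
    using v by (auto simp: pverts_petersen card_2_iff)
  have "card ({..<5} - {a, b}) = 3"
    using ab by (subst card_Diff_subset) auto
  then obtain c d e where cde: "{..<5} - {a, b} = {c, d, e}" "distinct [c, d, e]"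
    by (auto simp: card_3_iff)
  then have dist: "distinct [a, b, c, d, e]" and sub: "{a, b, c, d, e} \<subseteq> {..<5}"
    using ab by auto
  \<comment> \<open>Rotating \<open>c\<close>, \<open>d\<close>, \<open>e\<close> runs through the
    three pairs of neighbours of \<open>v\<close>. The three candidate sets partition the six
    vertices that share exactly one element with \<open>v\<close>, so \<open>v\<close>,
    \<open>p\<close>, \<open>q\<close>, \<open>r\<close> are distinct.\<close>
  obtain p where p: "p \<in> {{a, e}, {b, d}}" "f p = f v"
    using mvd_coloring_petersen_walk[OF f dist sub] ab(1) by blast
  obtain q where q: "q \<in> {{a, c}, {b, e}}" "f q = f v"
    using mvd_coloring_petersen_walk[OF f, of a b d e c] dist sub ab(1) by auto
  obtain r where r: "r \<in> {{a, d}, {b, c}}" "f r = f v"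
    using mvd_coloring_petersen_walk[OF f, of a b e c d] dist sub ab(1) by auto
  have "{v, p, q, r} \<subseteq> ?C"
    using p q r v dist sub by (auto simp: pair_in_petersen)
  moreover have "card {v, p, q, r} = 4"
  proof -
    have "v \<noteq> p" "v \<noteq> q" "v \<noteq> r"
      using p(1) q(1) r(1) dist unfolding ab(1) by (auto simp: doubleton_eq_iff)
    moreover have "p \<noteq> q"
      using p(1) q(1) dist by (elim insertE emptyE) (auto simp: doubleton_eq_iff)
    moreover have "p \<noteq> r"
      using p(1) r(1) dist by (elim insertE emptyE) (auto simp: doubleton_eq_iff)
    moreover have "q \<noteq> r"
      using q(1) r(1) dist by (elim insertE emptyE) (auto simp: doubleton_eq_iff)
    ultimately show ?thesis by simp
  qed
  moreover have "finite ?C" using finite_pverts_petersen by simp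
  ultimately show ?thesis by (metis card_mono)
qed

text \<open>The color classes partition 10 vertices into sets of size at least 4, and three such
  classes would need 12.\<close>

lemma mvd_coloring_petersen_card_le:
  assumes f: "mvd_coloring petersen_graph f"
  shows "card (f ` pverts petersen_graph) \<le> 2"
proof -
  let ?V = "pverts petersen_graph"
  have "4 * card (f ` ?V) = (\<Sum>k\<in>f ` ?V. 4)" by simp
  also have "\<dots> \<le> (\<Sum>k\<in>f ` ?V. card {w \<in> ?V. f w = k})"
    using petersen_color_class_card[OF f] by (intro sum_mono) auto
  also have "\<dots> = card ?V"
    using sum.image_gen[OF finite_pverts_petersen, of "\<lambda>_. 1 :: nat" f] by simp
  finally show ?thesis by (simp add: card_pverts_petersen)
qed

lemma mvd_coloring_petersen_star:
  "mvd_coloring petersen_graph (\<lambda>A. if 0 \<in> A then 1 else 0)" (is "mvd_coloring ?G ?c")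
  unfolding mvd_coloring_def
proof (intro ballI impI)
  fix x y assume xy: "x \<in> pverts ?G" "y \<in> pverts ?G" "x \<noteq> y \<and> (x, y) \<notin> parcs ?G"
  have star: "\<exists>S. vertex_cut ?G x y S \<and> monochromatic ?c S"
    if "x \<in> pverts ?G" "y \<in> pverts ?G" "x \<noteq> y" "(x, y) \<notin> parcs ?G" "0 \<in> x" for x y
  proof (intro exI conjI)
    show "vertex_cut ?G x y {v. (x, v) \<in> parcs ?G}"
      using that by (intro vertex_cut_neighbourhood pair_graph_petersen_graph)
    show "monochromatic ?c {v. (x, v) \<in> parcs ?G}"
      using that by (auto simp: monochromatic_def parcs_petersen_iff)
  qed
  consider "0 \<in> x" | "0 \<in> y" | "0 \<notin> x" "0 \<notin> y" by blast
  then show "\<exists>S. vertex_cut ?G x y S \<and> monochromatic ?c S"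
  proof cases
    case 1
    then show ?thesis using star xy by blast
  next
    case 2
    have "(y, x) \<notin> parcs ?G" using xy by (auto simp: parcs_petersen_iff)
    then show ?thesis using star[of y x] 2 xy vertex_cut_commute by metis
  next
    case 3
    \<comment> \<open>Among the 2-subsets of \<open>{1..<5}\<close> the only one disjoint from
      \<open>x\<close> is its complement, so \<open>?K\<close> is the matching edge at
      \<open>x\<close> left after deleting \<open>?S\<close>.\<close>
    let ?S = "{A \<in> pverts ?G. 0 \<in> A}" and ?K = "{x, {1..<5} - x}"
    have complement: "v = {1..<5} - u"
      if "u \<in> pverts ?G" "v \<in> pverts ?G" "u \<inter> v = {}" "0 \<notin> u" "0 \<notin> v" for u v
    proof (rule card_subset_eq)
      have u: "u \<subseteq> {1..<5}" "v \<subseteq> {1..<5}" "card u = 2" "card v = 2"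
        using that by (auto simp: pverts_petersen Suc_le_eq intro: gr0I)
      then show "v \<subseteq> {1..<5} - u" "finite ({1..<5} - u)" using that by auto
      have "finite u" using u(1) finite_subset by blast
      then show "card v = card ({1..<5} - u)"
        using u by (simp add: card_Diff_subset)
    qed
    have sub: "x \<subseteq> {1..<5}" using xy(1) 3
      by (auto simp: pverts_petersen Suc_le_eq intro: gr0I)
    \<comment> \<open>Being the complement of \<open>x\<close> would make \<open>y\<close> adjacent
      to \<open>x\<close>.\<close>
    have y: "y \<notin> ?K"
      using xy by (auto simp: parcs_petersen_iff)
    have closed: "\<forall>u\<in>?K. \<forall>v. (u, v) \<in> parcs ?G \<and> v \<notin> ?S \<longrightarrow> v \<in> ?K"
    proof (intro ballI allI impI)
      fix u v assume u: "u \<in> ?K" and "(u, v) \<in> parcs ?G \<and> v \<notin> ?S"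
      moreover have "0 \<notin> u" using u 3 by auto
      ultimately have "v = {1..<5} - u"
        by (intro complement) (auto simp: parcs_petersen_iff)
      then show "v \<in> ?K" using u sub by blast
    qed
    have "?S \<subseteq> pverts ?G - {x, y}" using 3 by auto
    then have "vertex_cut ?G x y ?S"
      unfolding vertex_cut_iff_closed_set[OF pair_graph_petersen_graph xy(1,2)]
      by (intro conjI exI[of _ ?K] insertI1 y closed)
    moreover have "monochromatic ?c ?S" by (auto simp: monochromatic_def)
    ultimately show ?thesis by blast
  qed
qed

lemma mvd_petersen: "mvd petersen_graph = 2"
proof (rule mvd_eqI[OF pair_graph_petersen_graph mvd_coloring_petersen_star])
  let ?c = "\<lambda>A :: nat set. if 0 \<in> A then 1 else 0 :: nat"
  \<comment> \<open>One vertex containing 0 and one avoiding it show that both colors occur.\<close>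
  have "{0, 1} \<in> pverts petersen_graph" "{1, 2} \<in> pverts petersen_graph"
    by (auto simp: pair_in_petersen)
  then have "{?c {0, 1}, ?c {1, 2}} \<subseteq> ?c ` pverts petersen_graph" by blast
  then have "?c ` pverts petersen_graph = {0, 1}" by auto
  then show "card (?c ` pverts petersen_graph) = 2" by simp
qed (rule mvd_coloring_petersen_card_le)

theorem theorem3p2:
  shows "(\<forall>m n :: nat. (m \<ge> 2 \<and> n \<ge> 2) \<or> {m, n} = {1, 2} \<longrightarrow>
            mvd (path_graph m \<box> path_graph n) = 2) \<and>
         mvd petersen_graph = 2"
  using mvd_grid mvd_petersen by blast

end
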